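(* Let $X$ be singular, let $i:Z=\mathrm{Sing}(X)\hookrightarrow X$ and $j:U=X_{\mathrm{reg}}\hookrightarrow X$ be the singular locus and its regular open complement (satisfying the recollement axioms), and let $C$ be a characteristic theory with values in $A\in\mathcal C(X)$ providing classes $C(X)$ and $C^{\mathrm{vir}}(X)$ with $j^*C^{\mathrm{vir}}(X)=j^*C(X)$, with defect $\Delta_C(X)=C^{\mathrm{vir}}(X)-C(X)$. Let $\mathcal M^C_Z$ be any assignment which associates to the Milnor defect $\Delta_C(X)$ a class $$\mathcal M^C_Z(X)\in\mathrm{Hom}_{\mathcal C(Z)}(\mathbf 1_Z,i^!A[*])$$ whose adjoint $\widetilde{\mathcal M}^C_Z(X):\mathbf 1_X\to i_*i^!A[*]$ satisfies $\mathrm{forg}\bigl(\widetilde{\mathcal M}^C_Z(X)\bigr)=\Delta_C(X)$. Then $\mathcal M^C_Z(X)$ determines a point of the Milnor localisation torsor $\mathfrak{Mil}^C_Z(X)$. If $\mathfrak{Mil}^C_Z(X)$ is a singleton, every such compatible construction gives the same localised Milnor class.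
   Context: Setting: to each space $X$ is attached a stable triangulated category $\mathcal C(X)$ with a symmetric monoidal structure $(\otimes,\mathbf 1_X)$. Each morphism $f$ has exact functors $f^*\dashv f_*$ with $f^*$ symmetric monoidal. Recollement axioms for a closed immersion $i:Z\hookrightarrow X$ with open complement $j:U\hookrightarrow X$: adjunctions $i^*\dashv i_*\dashv i^!$, $j_!\dashv j^*\dashv j_*$; $i_*,j_!$ fully faithful; $j^*i_*=0$, $i^*j_!=0$; functorial distinguished triangles $j_!j^*M\to M\to i_*i^*M\xrightarrow{+1}$, $i_*i^!M\to M\to j_*j^*M\xrightarrow{+1}$. Notation: $H^d(X;A)=\mathrm{Hom}(\mathbf 1_X,A[d])$; $H^d_Z(X;A)=\mathrm{Hom}(\mathbf 1_X,i_*i^!A[d])$; $\mathrm{forg}:H_Z^d(X;A)\to H^d(X;A)$ is induced by the counit $i_*i^!A\to A$. "Adjoint" refers to the adjunction isomorphism $H_Z^d(X;A)\cong\mathrm{Hom}_{\mathcal C(Z)}(\mathbf 1_Z,i^!A[d])$ (using $i^*\mathbf 1_X\simeq\mathbf 1_Z$). An asterisk denotes the relevant (graded) degrees. Characteristic theory $C$ with values in a coefficient object $A$: it provides a functorial class $C(X)\in H^*(X;A)$ and a virtual, expected, or Fulton-type class $C^{\mathrm{vir}}(X)\in H^*(X;A)$; only these two classes and their agreement on $U$ are used. The Milnor localisation torsor is $$\mathfrak{Mil}^C_Z(X)=\{\widetilde\Delta\in H^*_Z(X;A)\mid\mathrm{forg}(\widetilde\Delta)=\Delta_C(X)\}.$$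 *)

theory Defs
  imports "HOL-Algebra.Group" "HOL-Analysis.Abstract_Topology"
begin

section \<open>Categories, functors, adjunctions\<close>

record ('o, 'm) cat =
  Ob :: "'o set"
  Ar :: "'m set"
  Dom :: "'m \<Rightarrow> 'o"
  Cod :: "'m \<Rightarrow> 'o"
  Id :: "'o \<Rightarrow> 'm"
  Comp :: "'m \<Rightarrow> 'm \<Rightarrow> 'm"  (infixr \<open>\<cdot>\<index>\<close> 75)

definition mor :: "('o, 'm, 'z) cat_scheme \<Rightarrow> 'o \<Rightarrow> 'o \<Rightarrow> 'm set" where
  "mor C a b = {f \<in> Ar C. Dom C f = a \<and> Cod C f = b}"

locale category =
  fixes C :: "('o, 'm, 'z) cat_scheme" (structure)
  assumes Dom_Ob: "f \<in> Ar C \<Longrightarrow> Dom C f \<in> Ob C"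
    and Cod_Ob: "f \<in> Ar C \<Longrightarrow> Cod C f \<in> Ob C"
    and Id_mor: "a \<in> Ob C \<Longrightarrow> Id C a \<in> mor C a a"
    and Comp_mor: "\<lbrakk>f \<in> mor C a b; g \<in> mor C b c\<rbrakk> \<Longrightarrow> g \<cdot> f \<in> mor C a c"
    and Comp_Id: "f \<in> mor C a b \<Longrightarrow> f \<cdot> Id C a = f"
    and Id_Comp: "f \<in> mor C a b \<Longrightarrow> Id C b \<cdot> f = f"
    and Comp_assoc: "\<lbrakk>f \<in> mor C a b; g \<in> mor C b c; h \<in> mor C c d\<rbrakk>
      \<Longrightarrow> (h \<cdot> g) \<cdot> f = h \<cdot> (g \<cdot> f)"

definition inverse_arrows :: "('o, 'm, 'z) cat_scheme \<Rightarrow> 'm \<Rightarrow> 'm \<Rightarrow> bool" where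
  "inverse_arrows C f g \<longleftrightarrow> f \<in> Ar C \<and> g \<in> mor C (Cod C f) (Dom C f)
     \<and> g \<cdot>\<^bsub>C\<^esub> f = Id C (Dom C f) \<and> f \<cdot>\<^bsub>C\<^esub> g = Id C (Cod C f)"

definition iso_arrow :: "('o, 'm, 'z) cat_scheme \<Rightarrow> 'm \<Rightarrow> bool" where
  "iso_arrow C f \<longleftrightarrow> (\<exists>g. inverse_arrows C f g)"

definition inv_arrow :: "('o, 'm, 'z) cat_scheme \<Rightarrow> 'm \<Rightarrow> 'm" where
  "inv_arrow C f = (THE g. inverse_arrows C f g)"

definition zero_object :: "('o, 'm, 'z) cat_scheme \<Rightarrow> 'o \<Rightarrow> bool" where
  "zero_object C a \<longleftrightarrow> a \<in> Ob C \<and> (\<forall>b \<in> Ob C. (\<exists>!f. f \<in> mor C a b) \<and> (\<exists>!f. f \<in> mor C b a))"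

record ('o, 'm, 'o2, 'm2) ftor =
  fob :: "'o \<Rightarrow> 'o2"
  far :: "'m \<Rightarrow> 'm2"

definition id_ftor :: "('o, 'm, 'o, 'm) ftor" where
  "id_ftor = \<lparr>fob = (\<lambda>a. a), far = (\<lambda>f. f)\<rparr>"

definition comp_ftor ::
    "('o2, 'm2, 'o3, 'm3) ftor \<Rightarrow> ('o, 'm, 'o2, 'm2) ftor \<Rightarrow> ('o, 'm, 'o3, 'm3) ftor"
    (infixr \<open>\<circ>\<^sub>F\<close> 75) where
  "G \<circ>\<^sub>F F = \<lparr>fob = fob G \<circ> fob F, far = far G \<circ> far F\<rparr>"

definition is_functor :: "('o, 'm, 'z) cat_scheme \<Rightarrow> ('o2, 'm2, 'y) cat_scheme
    \<Rightarrow> ('o, 'm, 'o2, 'm2) ftor \<Rightarrow> bool" where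
  "is_functor C D F \<longleftrightarrow>
     (\<forall>a \<in> Ob C. fob F a \<in> Ob D) \<and>
     (\<forall>a b. \<forall>f \<in> mor C a b. far F f \<in> mor D (fob F a) (fob F b)) \<and>
     (\<forall>a \<in> Ob C. far F (Id C a) = Id D (fob F a)) \<and>
     (\<forall>a b c. \<forall>f \<in> mor C a b. \<forall>g \<in> mor C b c. far F (g \<cdot>\<^bsub>C\<^esub> f) = far F g \<cdot>\<^bsub>D\<^esub> far F f)"

definition fully_faithful :: "('o, 'm, 'z) cat_scheme \<Rightarrow> ('o2, 'm2, 'y) cat_scheme
    \<Rightarrow> ('o, 'm, 'o2, 'm2) ftor \<Rightarrow> bool" where
  "fully_faithful C D F \<longleftrightarrow>
     (\<forall>a \<in> Ob C. \<forall>b \<in> Ob C. bij_betw (far F) (mor C a b) (mor D (fob F a) (fob F b)))"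

definition natural :: "('o, 'm, 'z) cat_scheme \<Rightarrow> ('o2, 'm2, 'y) cat_scheme
    \<Rightarrow> ('o, 'm, 'o2, 'm2) ftor \<Rightarrow> ('o, 'm, 'o2, 'm2) ftor \<Rightarrow> ('o \<Rightarrow> 'm2) \<Rightarrow> bool" where
  "natural C D F G \<tau> \<longleftrightarrow>
     (\<forall>a \<in> Ob C. \<tau> a \<in> mor D (fob F a) (fob G a)) \<and>
     (\<forall>a b. \<forall>f \<in> mor C a b. \<tau> b \<cdot>\<^bsub>D\<^esub> far F f = far G f \<cdot>\<^bsub>D\<^esub> \<tau> a)"

text \<open>\<open>F \<stileturn> G\<close> with \<open>F : C \<rightarrow> D\<close>, unit \<open>\<eta>\<close> and counit \<open>\<epsilon>\<close>.\<close>

definition adjunction :: "('o, 'm, 'z) cat_scheme \<Rightarrow> ('o2, 'm2, 'y) cat_scheme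
    \<Rightarrow> ('o, 'm, 'o2, 'm2) ftor \<Rightarrow> ('o2, 'm2, 'o, 'm) ftor
    \<Rightarrow> ('o \<Rightarrow> 'm) \<Rightarrow> ('o2 \<Rightarrow> 'm2) \<Rightarrow> bool" where
  "adjunction C D F G \<eta> \<epsilon> \<longleftrightarrow>
     is_functor C D F \<and> is_functor D C G \<and>
     natural C C id_ftor (G \<circ>\<^sub>F F) \<eta> \<and> natural D D (F \<circ>\<^sub>F G) id_ftor \<epsilon> \<and>
     (\<forall>a \<in> Ob C. \<epsilon> (fob F a) \<cdot>\<^bsub>D\<^esub> far F (\<eta> a) = Id D (fob F a)) \<and>
     (\<forall>b \<in> Ob D. far G (\<epsilon> b) \<cdot>\<^bsub>C\<^esub> \<eta> (fob G b) = Id C (fob G b))"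


section \<open>Triangulated categories\<close>

text \<open>The translation is given, as in the Stacks project, by functors \<open>[n]\<close> for all integers
  \<open>n\<close> with \<open>[0] = id\<close> and \<open>[m + n] = [m] \<circ> [n]\<close>.\<close>

record ('o, 'm) tri_cat = "('o, 'm) cat" +
  Plus :: "'m \<Rightarrow> 'm \<Rightarrow> 'm"
  Zero :: "'o \<Rightarrow> 'o \<Rightarrow> 'm"
  Shift :: "int \<Rightarrow> ('o, 'm, 'o, 'm) ftor"
  Dist :: "('m \<times> 'm \<times> 'm) set"

definition mor_group :: "('o, 'm, 'z) tri_cat_scheme \<Rightarrow> 'o \<Rightarrow> 'o \<Rightarrow> 'm monoid" where
  "mor_group C a b = \<lparr>carrier = mor C a b, mult = Plus C, one = Zero C a b\<rparr>"

definition Neg :: "('o, 'm, 'z) tri_cat_scheme \<Rightarrow> 'm \<Rightarrow> 'm" where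
  "Neg C f = m_inv (mor_group C (Dom C f) (Cod C f)) f"

definition Minus :: "('o, 'm, 'z) tri_cat_scheme \<Rightarrow> 'm \<Rightarrow> 'm \<Rightarrow> 'm" where
  "Minus C f g = Plus C f (Neg C g)"

locale additive_category = category C
  for C :: "('o, 'm, 'z) tri_cat_scheme" (structure) +
  assumes mor_group: "\<lbrakk>a \<in> Ob C; b \<in> Ob C\<rbrakk> \<Longrightarrow> comm_group (mor_group C a b)"
    and Comp_Plus: "\<lbrakk>f \<in> mor C a b; f' \<in> mor C a b; g \<in> mor C b c\<rbrakk>
      \<Longrightarrow> g \<cdot> Plus C f f' = Plus C (g \<cdot> f) (g \<cdot> f')"
    and Plus_Comp: "\<lbrakk>f \<in> mor C a b; g \<in> mor C b c; g' \<in> mor C b c\<rbrakk>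
      \<Longrightarrow> Plus C g g' \<cdot> f = Plus C (g \<cdot> f) (g' \<cdot> f)"
    and ex_zero: "\<exists>a. zero_object C a"
    and ex_biproduct: "\<lbrakk>a \<in> Ob C; b \<in> Ob C\<rbrakk> \<Longrightarrow>
      \<exists>s \<in> Ob C. \<exists>i \<in> mor C a s. \<exists>j \<in> mor C b s. \<exists>p \<in> mor C s a. \<exists>q \<in> mor C s b.
        p \<cdot> i = Id C a \<and> q \<cdot> j = Id C b \<and> p \<cdot> j = Zero C b a \<and> q \<cdot> i = Zero C a b \<and>
        Plus C (i \<cdot> p) (j \<cdot> q) = Id C s"

definition additive_functor :: "('o, 'm, 'z) tri_cat_scheme \<Rightarrow> ('o2, 'm2, 'y) tri_cat_scheme
    \<Rightarrow> ('o, 'm, 'o2, 'm2) ftor \<Rightarrow> bool" where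
  "additive_functor C D F \<longleftrightarrow> is_functor C D F \<and>
     (\<forall>a b. \<forall>f \<in> mor C a b. \<forall>g \<in> mor C a b. far F (Plus C f g) = Plus D (far F f) (far F g))"

abbreviation sho :: "('o, 'm, 'z) tri_cat_scheme \<Rightarrow> 'o \<Rightarrow> int \<Rightarrow> 'o" where
  "sho C a n \<equiv> fob (Shift C n) a"

abbreviation sha :: "('o, 'm, 'z) tri_cat_scheme \<Rightarrow> 'm \<Rightarrow> int \<Rightarrow> 'm" where
  "sha C f n \<equiv> far (Shift C n) f"

definition triangle :: "('o, 'm, 'z) tri_cat_scheme \<Rightarrow> 'm \<times> 'm \<times> 'm \<Rightarrow> bool" where
  "triangle C = (\<lambda>(f, g, h). f \<in> Ar C \<and> g \<in> Ar C \<and> h \<in> Ar C \<and> Cod C f = Dom C g \<and>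
     Cod C g = Dom C h \<and> Cod C h = sho C (Dom C f) 1)"

locale triangulated_category = additive_category C
  for C :: "('o, 'm, 'z) tri_cat_scheme" (structure) +
  assumes Shift_additive: "additive_functor C C (Shift C n)"
    and Shift_0_ob: "a \<in> Ob C \<Longrightarrow> sho C a 0 = a"
    and Shift_0_ar: "f \<in> Ar C \<Longrightarrow> sha C f 0 = f"
    and Shift_add_ob: "a \<in> Ob C \<Longrightarrow> sho C a (m + n) = sho C (sho C a n) m"
    and Shift_add_ar: "f \<in> Ar C \<Longrightarrow> sha C f (m + n) = sha C (sha C f n) m"
    and Dist_triangle: "t \<in> Dist C \<Longrightarrow> triangle C t"
    and TR1_iso: "\<lbrakk>(f, g, h) \<in> Dist C; triangle C (f', g', h');
        x \<in> mor C (Dom C f) (Dom C f'); iso_arrow C x;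
        y \<in> mor C (Dom C g) (Dom C g'); iso_arrow C y;
        z \<in> mor C (Dom C h) (Dom C h'); iso_arrow C z;
        y \<cdot> f = f' \<cdot> x; z \<cdot> g = g' \<cdot> y; sha C x 1 \<cdot> h = h' \<cdot> z\<rbrakk>
      \<Longrightarrow> (f', g', h') \<in> Dist C"
    and TR1_id: "\<lbrakk>a \<in> Ob C; zero_object C w\<rbrakk>
      \<Longrightarrow> (Id C a, Zero C a w, Zero C w (sho C a 1)) \<in> Dist C"
    and TR1_cone: "f \<in> Ar C \<Longrightarrow> \<exists>g h. (f, g, h) \<in> Dist C"
    and TR2: "triangle C (f, g, h)
      \<Longrightarrow> (f, g, h) \<in> Dist C \<longleftrightarrow> (g, h, Neg C (sha C f 1)) \<in> Dist C"
    and TR3: "\<lbrakk>(f, g, h) \<in> Dist C; (f', g', h') \<in> Dist C;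
        x \<in> mor C (Dom C f) (Dom C f'); y \<in> mor C (Dom C g) (Dom C g'); y \<cdot> f = f' \<cdot> x\<rbrakk>
      \<Longrightarrow> \<exists>z \<in> mor C (Dom C h) (Dom C h'). z \<cdot> g = g' \<cdot> y \<and> sha C x 1 \<cdot> h = h' \<cdot> z"
    and TR4: "\<lbrakk>f \<in> mor C a b; g \<in> mor C b c;
        (f, p1, d1) \<in> Dist C; (g \<cdot> f, p2, d2) \<in> Dist C; (g, p3, d3) \<in> Dist C\<rbrakk>
      \<Longrightarrow> \<exists>u \<in> mor C (Cod C p1) (Cod C p2). \<exists>v \<in> mor C (Cod C p2) (Cod C p3).
        (u, v, sha C p1 1 \<cdot> d3) \<in> Dist C \<and>
        u \<cdot> p1 = p2 \<cdot> g \<and> d2 \<cdot> u = d1 \<and> v \<cdot> p2 = p3 \<and> d3 \<cdot> v = sha C f 1 \<cdot> d2"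

text \<open>An exact functor carries its comparison isomorphisms \<open>\<xi> a : F(a[1]) \<rightarrow> F(a)[1]\<close>.\<close>

definition exact_functor :: "('o, 'm, 'z) tri_cat_scheme \<Rightarrow> ('o2, 'm2, 'y) tri_cat_scheme
    \<Rightarrow> ('o, 'm, 'o2, 'm2) ftor \<Rightarrow> ('o \<Rightarrow> 'm2) \<Rightarrow> bool" where
  "exact_functor C D F \<xi> \<longleftrightarrow> additive_functor C D F \<and>
     natural C D (F \<circ>\<^sub>F Shift C 1) (Shift D 1 \<circ>\<^sub>F F) \<xi> \<and>
     (\<forall>a \<in> Ob C. iso_arrow D (\<xi> a)) \<and>
     (\<forall>f g h. (f, g, h) \<in> Dist C \<longrightarrow>
        (far F f, far F g, \<xi> (Dom C f) \<cdot>\<^bsub>D\<^esub> far F h) \<in> Dist D)"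

text \<open>The induced isomorphisms \<open>F(a[n]) \<rightarrow> F(a)[n]\<close>: by iteration of \<open>\<xi>\<close> for \<open>n \<ge> 0\<close>; for
  \<open>n = -k < 0\<close> as the inverse of the \<open>-k\<close>-shift of
  \<open>F(a) = F(a[-k][k]) \<rightarrow> F(a[-k])[k]\<close>.\<close>

primrec shift_iso_nat :: "('o, 'm, 'z) tri_cat_scheme \<Rightarrow> ('o2, 'm2, 'y) tri_cat_scheme
    \<Rightarrow> ('o, 'm, 'o2, 'm2) ftor \<Rightarrow> ('o \<Rightarrow> 'm2) \<Rightarrow> nat \<Rightarrow> 'o \<Rightarrow> 'm2" where
  "shift_iso_nat C D F \<xi> 0 a = Id D (fob F a)"
| "shift_iso_nat C D F \<xi> (Suc n) a =
     sha D (shift_iso_nat C D F \<xi> n a) 1 \<cdot>\<^bsub>D\<^esub> \<xi> (sho C a (int n))"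

definition shift_iso :: "('o, 'm, 'z) tri_cat_scheme \<Rightarrow> ('o2, 'm2, 'y) tri_cat_scheme
    \<Rightarrow> ('o, 'm, 'o2, 'm2) ftor \<Rightarrow> ('o \<Rightarrow> 'm2) \<Rightarrow> int \<Rightarrow> 'o \<Rightarrow> 'm2" where
  "shift_iso C D F \<xi> n a =
     (if 0 \<le> n then shift_iso_nat C D F \<xi> (nat n) a
      else inv_arrow D (sha D (shift_iso_nat C D F \<xi> (nat (- n)) (sho C a n)) n))"


section \<open>Symmetric monoidal structures\<close>

record ('o, 'm) smt_cat = "('o, 'm) tri_cat" +
  Tob :: "'o \<Rightarrow> 'o \<Rightarrow> 'o"
  Tar :: "'m \<Rightarrow> 'm \<Rightarrow> 'm"
  Unit :: "'o"
  Assoc :: "'o \<Rightarrow> 'o \<Rightarrow> 'o \<Rightarrow> 'm"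
  LUnit :: "'o \<Rightarrow> 'm"
  RUnit :: "'o \<Rightarrow> 'm"
  Braid :: "'o \<Rightarrow> 'o \<Rightarrow> 'm"

locale sym_monoidal_category = category C
  for C :: "('o, 'm, 'z) smt_cat_scheme" (structure) +
  assumes Tob_Ob: "\<lbrakk>a \<in> Ob C; b \<in> Ob C\<rbrakk> \<Longrightarrow> Tob C a b \<in> Ob C"
    and Unit_Ob: "Unit C \<in> Ob C"
    and Tar_mor: "\<lbrakk>f \<in> mor C a b; g \<in> mor C c d\<rbrakk> \<Longrightarrow> Tar C f g \<in> mor C (Tob C a c) (Tob C b d)"
    and Tar_Id: "\<lbrakk>a \<in> Ob C; b \<in> Ob C\<rbrakk> \<Longrightarrow> Tar C (Id C a) (Id C b) = Id C (Tob C a b)"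
    and Tar_Comp: "\<lbrakk>f \<in> mor C a b; f' \<in> mor C b c; g \<in> mor C a' b'; g' \<in> mor C b' c'\<rbrakk>
      \<Longrightarrow> Tar C (f' \<cdot> f) (g' \<cdot> g) = Tar C f' g' \<cdot> Tar C f g"
    and Assoc_mor: "\<lbrakk>a \<in> Ob C; b \<in> Ob C; c \<in> Ob C\<rbrakk>
      \<Longrightarrow> Assoc C a b c \<in> mor C (Tob C (Tob C a b) c) (Tob C a (Tob C b c))"
    and Assoc_iso: "\<lbrakk>a \<in> Ob C; b \<in> Ob C; c \<in> Ob C\<rbrakk> \<Longrightarrow> iso_arrow C (Assoc C a b c)"
    and Assoc_nat: "\<lbrakk>f \<in> mor C a a'; g \<in> mor C b b'; h \<in> mor C c c'\<rbrakk>
      \<Longrightarrow> Assoc C a' b' c' \<cdot> Tar C (Tar C f g) h = Tar C f (Tar C g h) \<cdot> Assoc C a b c"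
    and LUnit_mor: "a \<in> Ob C \<Longrightarrow> LUnit C a \<in> mor C (Tob C (Unit C) a) a"
    and LUnit_iso: "a \<in> Ob C \<Longrightarrow> iso_arrow C (LUnit C a)"
    and LUnit_nat: "f \<in> mor C a b \<Longrightarrow> LUnit C b \<cdot> Tar C (Id C (Unit C)) f = f \<cdot> LUnit C a"
    and RUnit_mor: "a \<in> Ob C \<Longrightarrow> RUnit C a \<in> mor C (Tob C a (Unit C)) a"
    and RUnit_iso: "a \<in> Ob C \<Longrightarrow> iso_arrow C (RUnit C a)"
    and RUnit_nat: "f \<in> mor C a b \<Longrightarrow> RUnit C b \<cdot> Tar C f (Id C (Unit C)) = f \<cdot> RUnit C a"
    and Braid_mor: "\<lbrakk>a \<in> Ob C; b \<in> Ob C\<rbrakk> \<Longrightarrow> Braid C a b \<in> mor C (Tob C a b) (Tob C b a)"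
    and Braid_nat: "\<lbrakk>f \<in> mor C a a'; g \<in> mor C b b'\<rbrakk>
      \<Longrightarrow> Braid C a' b' \<cdot> Tar C f g = Tar C g f \<cdot> Braid C a b"
    and Braid_sym: "\<lbrakk>a \<in> Ob C; b \<in> Ob C\<rbrakk> \<Longrightarrow> Braid C b a \<cdot> Braid C a b = Id C (Tob C a b)"
    and pentagon: "\<lbrakk>a \<in> Ob C; b \<in> Ob C; c \<in> Ob C; d \<in> Ob C\<rbrakk>
      \<Longrightarrow> Assoc C a b (Tob C c d) \<cdot> Assoc C (Tob C a b) c d =
          Tar C (Id C a) (Assoc C b c d) \<cdot> Assoc C a (Tob C b c) d \<cdot> Tar C (Assoc C a b c) (Id C d)"
    and triangle_coherence: "\<lbrakk>a \<in> Ob C; b \<in> Ob C\<rbrakk>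
      \<Longrightarrow> Tar C (Id C a) (LUnit C b) \<cdot> Assoc C a (Unit C) b = Tar C (RUnit C a) (Id C b)"
    and hexagon: "\<lbrakk>a \<in> Ob C; b \<in> Ob C; c \<in> Ob C\<rbrakk>
      \<Longrightarrow> Assoc C b c a \<cdot> Braid C a (Tob C b c) \<cdot> Assoc C a b c =
          Tar C (Id C b) (Braid C a c) \<cdot> Assoc C b a c \<cdot> Tar C (Braid C a b) (Id C c)"

text \<open>Strong symmetric monoidal functors, with structure isomorphisms
  \<open>\<mu> a b : F a \<otimes> F b \<rightarrow> F (a \<otimes> b)\<close> and \<open>\<iota> : 1 \<rightarrow> F 1\<close>.\<close>

locale sym_monoidal_functor = C: sym_monoidal_category C + D: sym_monoidal_category D
  for C :: "('o, 'm, 'z) smt_cat_scheme" and D :: "('o2, 'm2, 'y) smt_cat_scheme" +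
  fixes F :: "('o, 'm, 'o2, 'm2) ftor" and \<mu> :: "'o \<Rightarrow> 'o \<Rightarrow> 'm2" and \<iota> :: 'm2
  assumes functor_F: "is_functor C D F"
    and mu_mor: "\<lbrakk>a \<in> Ob C; b \<in> Ob C\<rbrakk>
      \<Longrightarrow> \<mu> a b \<in> mor D (Tob D (fob F a) (fob F b)) (fob F (Tob C a b))"
    and mu_iso: "\<lbrakk>a \<in> Ob C; b \<in> Ob C\<rbrakk> \<Longrightarrow> iso_arrow D (\<mu> a b)"
    and mu_nat: "\<lbrakk>f \<in> mor C a a'; g \<in> mor C b b'\<rbrakk>
      \<Longrightarrow> \<mu> a' b' \<cdot>\<^bsub>D\<^esub> Tar D (far F f) (far F g) = far F (Tar C f g) \<cdot>\<^bsub>D\<^esub> \<mu> a b"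
    and iota_mor: "\<iota> \<in> mor D (Unit D) (fob F (Unit C))"
    and iota_iso: "iso_arrow D \<iota>"
    and mu_assoc: "\<lbrakk>a \<in> Ob C; b \<in> Ob C; c \<in> Ob C\<rbrakk>
      \<Longrightarrow> far F (Assoc C a b c) \<cdot>\<^bsub>D\<^esub> \<mu> (Tob C a b) c \<cdot>\<^bsub>D\<^esub> Tar D (\<mu> a b) (Id D (fob F c)) =
          \<mu> a (Tob C b c) \<cdot>\<^bsub>D\<^esub> Tar D (Id D (fob F a)) (\<mu> b c)
            \<cdot>\<^bsub>D\<^esub> Assoc D (fob F a) (fob F b) (fob F c)"
    and mu_lunit: "a \<in> Ob C
      \<Longrightarrow> far F (LUnit C a) \<cdot>\<^bsub>D\<^esub> \<mu> (Unit C) a \<cdot>\<^bsub>D\<^esub> Tar D \<iota> (Id D (fob F a)) = LUnit D (fob F a)"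
    and mu_runit: "a \<in> Ob C
      \<Longrightarrow> far F (RUnit C a) \<cdot>\<^bsub>D\<^esub> \<mu> a (Unit C) \<cdot>\<^bsub>D\<^esub> Tar D (Id D (fob F a)) \<iota> = RUnit D (fob F a)"
    and mu_braid: "\<lbrakk>a \<in> Ob C; b \<in> Ob C\<rbrakk>
      \<Longrightarrow> far F (Braid C a b) \<cdot>\<^bsub>D\<^esub> \<mu> a b = \<mu> b a \<cdot>\<^bsub>D\<^esub> Braid D (fob F a) (fob F b)"


section \<open>Spaces\<close>

text \<open>The kind of space (schemes, complex analytic spaces etc.) is left open: spaces form a
  category with underlying topological spaces and continuous maps, distinguished classes of closed
  and open immersions, and a notion of regular point.\<close>

record ('s, 'f, 'p) geometry = "('s, 'f) cat" +
  Top :: "'s \<Rightarrow> 'p topology"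
  Pts :: "'f \<Rightarrow> 'p \<Rightarrow> 'p"
  ClosedImm :: "'f set"
  OpenImm :: "'f set"
  Reg :: "'s \<Rightarrow> 'p set"

locale geometry = category S
  for S :: "('s, 'f, 'p, 'z) geometry_scheme" +
  assumes Pts_continuous: "f \<in> mor S Y X \<Longrightarrow> continuous_map (Top S Y) (Top S X) (Pts S f)"
    and Pts_Id: "\<lbrakk>X \<in> Ob S; x \<in> topspace (Top S X)\<rbrakk> \<Longrightarrow> Pts S (Id S X) x = x"
    and Pts_Comp: "\<lbrakk>f \<in> mor S Z Y; g \<in> mor S Y X; x \<in> topspace (Top S Z)\<rbrakk>
      \<Longrightarrow> Pts S (g \<cdot>\<^bsub>S\<^esub> f) x = Pts S g (Pts S f x)"
    and ClosedImm_Ar: "ClosedImm S \<subseteq> Ar S"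
    and ClosedImm_closed_embedding: "f \<in> ClosedImm S \<Longrightarrow>
      embedding_map (Top S (Dom S f)) (Top S (Cod S f)) (Pts S f) \<and>
      closed_map (Top S (Dom S f)) (Top S (Cod S f)) (Pts S f)"
    and OpenImm_Ar: "OpenImm S \<subseteq> Ar S"
    and OpenImm_open_embedding: "f \<in> OpenImm S \<Longrightarrow>
      embedding_map (Top S (Dom S f)) (Top S (Cod S f)) (Pts S f) \<and>
      open_map (Top S (Dom S f)) (Top S (Cod S f)) (Pts S f)"
    and Reg_subset: "X \<in> Ob S \<Longrightarrow> Reg S X \<subseteq> topspace (Top S X)"

definition Sing :: "('s, 'f, 'p, 'z) geometry_scheme \<Rightarrow> 's \<Rightarrow> 'p set" where
  "Sing S X = topspace (Top S X) - Reg S X"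

definition singular :: "('s, 'f, 'p, 'z) geometry_scheme \<Rightarrow> 's \<Rightarrow> bool" where
  "singular S X \<longleftrightarrow> X \<in> Ob S \<and> Sing S X \<noteq> {}"

definition singular_locus :: "('s, 'f, 'p, 'z) geometry_scheme \<Rightarrow> 'f \<Rightarrow> 's \<Rightarrow> 's \<Rightarrow> bool" where
  "singular_locus S i Z X \<longleftrightarrow> i \<in> mor S Z X \<and> i \<in> ClosedImm S \<and>
     Pts S i ` topspace (Top S Z) = Sing S X"

definition regular_locus :: "('s, 'f, 'p, 'z) geometry_scheme \<Rightarrow> 'f \<Rightarrow> 's \<Rightarrow> 's \<Rightarrow> bool" where
  "regular_locus S j U X \<longleftrightarrow> j \<in> mor S U X \<and> j \<in> OpenImm S \<and>
     Pts S j ` topspace (Top S U) = Reg S X"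


section \<open>Coefficient systems and recollement\<close>

text \<open>For \<open>f : Y \<rightarrow> X\<close>: \<open>pull f = f\<^sup>* : C(X) \<rightarrow> C(Y)\<close> and \<open>push f = f\<^sub>* : C(Y) \<rightarrow> C(X)\<close> with the
  unit and counit of \<open>f\<^sup>* \<stileturn> f\<^sub>*\<close>, the exactness data \<open>pull_xi\<close>, \<open>push_xi\<close>, and the monoidal
  structure \<open>pull_mu\<close>, \<open>pull_iota\<close> of \<open>f\<^sup>*\<close>.\<close>

record ('s, 'f, 'o, 'm) coefficients =
  CC :: "'s \<Rightarrow> ('o, 'm) smt_cat"
  pull :: "'f \<Rightarrow> ('o, 'm, 'o, 'm) ftor"
  push :: "'f \<Rightarrow> ('o, 'm, 'o, 'm) ftor"
  ps_unit :: "'f \<Rightarrow> 'o \<Rightarrow> 'm"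
  ps_counit :: "'f \<Rightarrow> 'o \<Rightarrow> 'm"
  pull_xi :: "'f \<Rightarrow> 'o \<Rightarrow> 'm"
  push_xi :: "'f \<Rightarrow> 'o \<Rightarrow> 'm"
  pull_mu :: "'f \<Rightarrow> 'o \<Rightarrow> 'o \<Rightarrow> 'm"
  pull_iota :: "'f \<Rightarrow> 'm"

locale coefficient_system = geometry S
  for S :: "('s, 'f, 'p, 'z) geometry_scheme" +
  fixes K :: "('s, 'f, 'o, 'm) coefficients"
  assumes CC_triangulated: "X \<in> Ob S \<Longrightarrow> triangulated_category (CC K X)"
    and CC_sym_monoidal: "X \<in> Ob S \<Longrightarrow> sym_monoidal_category (CC K X)"
    and pull_exact: "f \<in> mor S Y X \<Longrightarrow> exact_functor (CC K X) (CC K Y) (pull K f) (pull_xi K f)"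
    and push_exact: "f \<in> mor S Y X \<Longrightarrow> exact_functor (CC K Y) (CC K X) (push K f) (push_xi K f)"
    and pull_push: "f \<in> mor S Y X \<Longrightarrow>
      adjunction (CC K X) (CC K Y) (pull K f) (push K f) (ps_unit K f) (ps_counit K f)"
    and pull_sym_monoidal: "f \<in> mor S Y X \<Longrightarrow>
      sym_monoidal_functor (CC K X) (CC K Y) (pull K f) (pull_mu K f) (pull_iota K f)"

text \<open>The additional functors of a recollement, with the (co)units of \<open>i\<^sub>* \<stileturn> i\<^sup>!\<close> and
  \<open>j\<^sub>! \<stileturn> j\<^sup>*\<close> and the connecting morphisms
  \<open>i\<^sub>*i\<^sup>*M \<rightarrow> j\<^sub>!j\<^sup>*M[1]\<close> and \<open>j\<^sub>*j\<^sup>*M \<rightarrow> i\<^sub>*i\<^sup>!M[1]\<close>.\<close>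

record ('o, 'm) recollement_data =
  ishriek :: "('o, 'm, 'o, 'm) ftor"
  jshriek :: "('o, 'm, 'o, 'm) ftor"
  is_unit :: "'o \<Rightarrow> 'm"
  is_counit :: "'o \<Rightarrow> 'm"
  js_unit :: "'o \<Rightarrow> 'm"
  js_counit :: "'o \<Rightarrow> 'm"
  conn1 :: "'o \<Rightarrow> 'm"
  conn2 :: "'o \<Rightarrow> 'm"

locale recollement =
  fixes K :: "('s, 'f, 'o, 'm) coefficients" and X Z U :: 's and i j :: 'f
    and R :: "('o, 'm) recollement_data"
  assumes istar_ishriek: "adjunction (CC K Z) (CC K X) (push K i) (ishriek R) (is_unit R) (is_counit R)"
    and jshriek_jstar: "adjunction (CC K U) (CC K X) (jshriek R) (pull K j) (js_unit R) (js_counit R)"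
    and istar_ff: "fully_faithful (CC K Z) (CC K X) (push K i)"
    and jshriek_ff: "fully_faithful (CC K U) (CC K X) (jshriek R)"
    and jstar_istar: "N \<in> Ob (CC K Z) \<Longrightarrow> zero_object (CC K U) (fob (pull K j) (fob (push K i) N))"
    and istar_jshriek: "N \<in> Ob (CC K U) \<Longrightarrow> zero_object (CC K Z) (fob (pull K i) (fob (jshriek R) N))"
    and conn1_nat: "natural (CC K X) (CC K X) (push K i \<circ>\<^sub>F pull K i)
      (Shift (CC K X) 1 \<circ>\<^sub>F jshriek R \<circ>\<^sub>F pull K j) (conn1 R)"
    and triangle1: "M \<in> Ob (CC K X) \<Longrightarrow> (js_counit R M, ps_unit K i M, conn1 R M) \<in> Dist (CC K X)"
    and conn2_nat: "natural (CC K X) (CC K X) (push K j \<circ>\<^sub>F pull K j)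
      (Shift (CC K X) 1 \<circ>\<^sub>F push K i \<circ>\<^sub>F ishriek R) (conn2 R)"
    and triangle2: "M \<in> Ob (CC K X) \<Longrightarrow> (is_counit R M, ps_unit K j M, conn2 R M) \<in> Dist (CC K X)"


section \<open>Cohomology, forgetting supports, and the Milnor localisation torsor\<close>

text \<open>\<open>D\<close> is the set of relevant degrees; a class of degree \<open>*\<close> is a family indexed by \<open>D\<close>.
  The shift binds weakest: \<open>i\<^sub>*i\<^sup>!A[d]\<close> is \<open>(i\<^sub>*i\<^sup>!A)[d]\<close>.\<close>

definition graded_hom :: "('o, 'm, 'z) tri_cat_scheme \<Rightarrow> int set \<Rightarrow> 'o \<Rightarrow> 'o \<Rightarrow> (int \<Rightarrow> 'm) set" where
  "graded_hom C D a b = (\<Pi>\<^sub>E d\<in>D. mor C a (sho C b d))"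

definition H :: "('s, 'f, 'o, 'm) coefficients \<Rightarrow> int set \<Rightarrow> 's \<Rightarrow> 'o \<Rightarrow> (int \<Rightarrow> 'm) set" where
  "H K D X A = graded_hom (CC K X) D (Unit (CC K X)) A"

definition H_supp :: "('s, 'f, 'o, 'm) coefficients \<Rightarrow> ('o, 'm) recollement_data
    \<Rightarrow> int set \<Rightarrow> 'f \<Rightarrow> 's \<Rightarrow> 'o \<Rightarrow> (int \<Rightarrow> 'm) set" where
  "H_supp K R D i X A =
     graded_hom (CC K X) D (Unit (CC K X)) (fob (push K i) (fob (ishriek R) A))"

definition forg :: "('s, 'f, 'o, 'm) coefficients \<Rightarrow> ('o, 'm) recollement_data
    \<Rightarrow> int set \<Rightarrow> 's \<Rightarrow> 'o \<Rightarrow> (int \<Rightarrow> 'm) \<Rightarrow> int \<Rightarrow> 'm" where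
  "forg K R D X A t = (\<lambda>d\<in>D. sha (CC K X) (is_counit R A) d \<cdot>\<^bsub>CC K X\<^esub> t d)"

text \<open>\<open>j\<^sup>* : H\<^sup>*(X;A) \<rightarrow> H\<^sup>*(U;j\<^sup>*A)\<close>, sending \<open>c : 1 \<rightarrow> A[d]\<close> to
  \<open>1 \<cong> j\<^sup>*1 \<rightarrow> j\<^sup>*(A[d]) \<cong> (j\<^sup>*A)[d]\<close>.\<close>

definition pull_class :: "('s, 'f, 'o, 'm) coefficients \<Rightarrow> int set \<Rightarrow> 'f \<Rightarrow> 's \<Rightarrow> 's
    \<Rightarrow> 'o \<Rightarrow> (int \<Rightarrow> 'm) \<Rightarrow> int \<Rightarrow> 'm" where
  "pull_class K D j U X A c =
     (\<lambda>d\<in>D. shift_iso (CC K X) (CC K U) (pull K j) (pull_xi K j) d A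
        \<cdot>\<^bsub>CC K U\<^esub> far (pull K j) (c d) \<cdot>\<^bsub>CC K U\<^esub> pull_iota K j)"

text \<open>The adjunction isomorphism \<open>Hom(1\<^sub>Z, (i\<^sup>!A)[d]) \<cong> Hom(1\<^sub>X, (i\<^sub>*i\<^sup>!A)[d])\<close>: \<open>m\<close> is sent to
  \<open>1\<^sub>X \<rightarrow> i\<^sub>*i\<^sup>*1\<^sub>X \<cong> i\<^sub>*1\<^sub>Z \<rightarrow> i\<^sub>*((i\<^sup>!A)[d]) \<cong> (i\<^sub>*i\<^sup>!A)[d]\<close>.\<close>

definition adjoint_class :: "('s, 'f, 'o, 'm) coefficients \<Rightarrow> ('o, 'm) recollement_data
    \<Rightarrow> int set \<Rightarrow> 'f \<Rightarrow> 's \<Rightarrow> 's \<Rightarrow> 'o \<Rightarrow> (int \<Rightarrow> 'm) \<Rightarrow> int \<Rightarrow> 'm" where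
  "adjoint_class K R D i Z X A m =
     (\<lambda>d\<in>D. shift_iso (CC K Z) (CC K X) (push K i) (push_xi K i) d (fob (ishriek R) A)
        \<cdot>\<^bsub>CC K X\<^esub> far (push K i) (m d \<cdot>\<^bsub>CC K Z\<^esub> inv_arrow (CC K Z) (pull_iota K i))
        \<cdot>\<^bsub>CC K X\<^esub> ps_unit K i (Unit (CC K X)))"

text \<open>Only the class \<open>cls\<close> and the virtual class \<open>vcls\<close> on \<open>X\<close> and their agreement on \<open>U\<close>
  matter, so functoriality in \<open>X\<close> is not part of the data and \<open>A\<close> lives over \<open>X\<close> only.\<close>

record 'm characteristic_theory =
  cls :: "int \<Rightarrow> 'm"
  vcls :: "int \<Rightarrow> 'm"

locale characteristic_theory =
  fixes K :: "('s, 'f, 'o, 'm) coefficients" and D :: "int set" and X U :: 's and j :: 'f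
    and A :: 'o and T :: "'m characteristic_theory"
  assumes A_Ob: "A \<in> Ob (CC K X)"
    and cls_H: "cls T \<in> H K D X A"
    and vcls_H: "vcls T \<in> H K D X A"
    and agree: "pull_class K D j U X A (vcls T) = pull_class K D j U X A (cls T)"

definition defect :: "('s, 'f, 'o, 'm) coefficients \<Rightarrow> int set \<Rightarrow> 's \<Rightarrow> 'm characteristic_theory
    \<Rightarrow> int \<Rightarrow> 'm" where
  "defect K D X T = (\<lambda>d\<in>D. Minus (CC K X) (vcls T d) (cls T d))"

definition milnor_torsor :: "('s, 'f, 'o, 'm) coefficients \<Rightarrow> ('o, 'm) recollement_data
    \<Rightarrow> int set \<Rightarrow> 'f \<Rightarrow> 's \<Rightarrow> 'o \<Rightarrow> 'm characteristic_theory \<Rightarrow> (int \<Rightarrow> 'm) set" where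
  "milnor_torsor K R D i X A T = {t \<in> H_supp K R D i X A. forg K R D X A t = defect K D X T}"

text \<open>An assignment \<open>\<M>\<close> sends defect classes to localised classes; only its value at the defect
  of \<open>X\<close> is constrained.\<close>

definition compatible_assignment :: "('s, 'f, 'o, 'm) coefficients \<Rightarrow> ('o, 'm) recollement_data
    \<Rightarrow> int set \<Rightarrow> 'f \<Rightarrow> 's \<Rightarrow> 's \<Rightarrow> 'o \<Rightarrow> 'm characteristic_theory
    \<Rightarrow> ((int \<Rightarrow> 'm) \<Rightarrow> int \<Rightarrow> 'm) \<Rightarrow> bool" where
  "compatible_assignment K R D i Z X A T \<M> \<longleftrightarrow>
     \<M> (defect K D X T) \<in> graded_hom (CC K Z) D (Unit (CC K Z)) (fob (ishriek R) A) \<and>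
     forg K R D X A (adjoint_class K R D i Z X A (\<M> (defect K D X T))) = defect K D X T"

end

theory Submission
  imports Defs
begin

text \<open>Passing to the adjoint is injective: it is transposition along \<open>i\<^sup>* \<stileturn> i\<^sub>*\<close> combined
  with the invertible arrows \<open>1\<^sub>Z \<rightarrow> i\<^sup>*1\<^sub>X\<close> and \<open>i\<^sub>*(B[d]) \<rightarrow> (i\<^sub>*B)[d]\<close>. Hence two compatible
  classes whose adjoints agree in a singleton torsor are equal.\<close>

section \<open>Inverses, isomorphisms and cancellation in a category\<close>

lemma inverse_arrows_mor:
  assumes "f \<in> mor C a b"
  shows "inverse_arrows C f g \<longleftrightarrow>
    g \<in> mor C b a \<and> g \<cdot>\<^bsub>C\<^esub> f = Id C a \<and> f \<cdot>\<^bsub>C\<^esub> g = Id C b"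
  using assms by (auto simp: inverse_arrows_def mor_def)

context category
begin

lemma mor_Ob: "f \<in> mor C a b \<Longrightarrow> a \<in> Ob C" "f \<in> mor C a b \<Longrightarrow> b \<in> Ob C"
  using Dom_Ob Cod_Ob by (auto simp: mor_def)

lemma inverse_arrows_unique:
  assumes f: "f \<in> mor C a b" and "inverse_arrows C f g" and "inverse_arrows C f h"
  shows "g = h"
proof -
  have g: "g \<in> mor C b a" "g \<cdot> f = Id C a" and h: "h \<in> mor C b a" "f \<cdot> h = Id C b"
    using assms inverse_arrows_mor[OF f] by auto
  have "g = g \<cdot> (f \<cdot> h)" using g h by (simp add: Comp_Id)
  also have "\<dots> = (g \<cdot> f) \<cdot> h" using Comp_assoc[OF h(1) f g(1)] by simp
  also have "\<dots> = h" using g h by (simp add: Id_Comp)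
  finally show ?thesis .
qed

text \<open>Since \<open>inv_arrow\<close> is a definite description, uniqueness of two-sided
  inverses is what makes it denote an actual inverse of an isomorphism.\<close>

lemma inverse_arrows_inv_arrow:
  assumes "f \<in> mor C a b" and "iso_arrow C f"
  shows "inverse_arrows C f (inv_arrow C f)"
proof -
  obtain g where "inverse_arrows C f g"
    using assms(2) by (auto simp: iso_arrow_def)
  then show ?thesis
    unfolding inv_arrow_def
    by (rule theI) (use assms(1) inverse_arrows_unique \<open>inverse_arrows C f g\<close> in blast)
qed

lemma inv_arrow:
  assumes f: "f \<in> mor C a b" and "iso_arrow C f"
  shows "inv_arrow C f \<in> mor C b a"
    and "inv_arrow C f \<cdot> f = Id C a"
    and "f \<cdot> inv_arrow C f = Id C b"
    and "iso_arrow C (inv_arrow C f)"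
proof -
  show g: "inv_arrow C f \<in> mor C b a" "inv_arrow C f \<cdot> f = Id C a" "f \<cdot> inv_arrow C f = Id C b"
    using inverse_arrows_inv_arrow[OF assms] inverse_arrows_mor[OF f] by auto
  show "iso_arrow C (inv_arrow C f)"
    unfolding iso_arrow_def using inverse_arrows_mor[OF g(1)] f g by auto
qed

lemma iso_arrow_Id: "a \<in> Ob C \<Longrightarrow> iso_arrow C (Id C a)"
  unfolding iso_arrow_def using inverse_arrows_mor[OF Id_mor] Id_mor Comp_Id by blast

lemma iso_arrow_Comp:
  assumes f: "f \<in> mor C a b" and g: "g \<in> mor C b c"
    and "iso_arrow C f" and "iso_arrow C g"
  shows "iso_arrow C (g \<cdot> f)"
proof -
  note f' = inv_arrow[OF f assms(3)] and g' = inv_arrow[OF g assms(4)]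
  have "(inv_arrow C f \<cdot> inv_arrow C g) \<cdot> (g \<cdot> f) = Id C a"
    using Comp_assoc[OF Comp_mor[OF f g] g'(1) f'(1)] Comp_assoc[OF f g g'(1)] f' g' f
    by (simp add: Id_Comp)
  moreover have "(g \<cdot> f) \<cdot> (inv_arrow C f \<cdot> inv_arrow C g) = Id C c"
    using Comp_assoc[OF Comp_mor[OF g'(1) f'(1)] f g] Comp_assoc[OF g'(1) f'(1) f] f' g' g
    by (simp add: Id_Comp)
  moreover have "inv_arrow C f \<cdot> inv_arrow C g \<in> mor C c a"
    using f'(1) g'(1) Comp_mor by blast
  ultimately show ?thesis
    unfolding iso_arrow_def using inverse_arrows_mor[OF Comp_mor[OF f g]] by blast
qed

lemma iso_arrow_left_cancel:
  assumes f: "f \<in> mor C b c" "iso_arrow C f" and g: "g \<in> mor C a b" and h: "h \<in> mor C a b"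
    and eq: "f \<cdot> g = f \<cdot> h"
  shows "g = h"
proof -
  note f' = inv_arrow[OF f]
  have "inv_arrow C f \<cdot> (f \<cdot> x) = x" if "x \<in> mor C a b" for x
    using Comp_assoc[OF that f(1) f'(1)] f'(2) that by (simp add: Id_Comp)
  then show ?thesis using eq g h by metis
qed

lemma iso_arrow_right_cancel:
  assumes f: "f \<in> mor C a b" "iso_arrow C f" and g: "g \<in> mor C b c" and h: "h \<in> mor C b c"
    and eq: "g \<cdot> f = h \<cdot> f"
  shows "g = h"
proof -
  note f' = inv_arrow[OF f]
  have "(x \<cdot> f) \<cdot> inv_arrow C f = x" if "x \<in> mor C b c" for x
    using Comp_assoc[OF f'(1) f(1) that] f'(3) that by (simp add: Comp_Id)
  then show ?thesis using eq g h by metis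
qed

end

section \<open>Functors and transposition along an adjunction\<close>

lemma is_functor_Ob: "is_functor C D F \<Longrightarrow> a \<in> Ob C \<Longrightarrow> fob F a \<in> Ob D"
  by (simp add: is_functor_def)

lemma is_functor_mor: "is_functor C D F \<Longrightarrow> f \<in> mor C a b \<Longrightarrow> far F f \<in> mor D (fob F a) (fob F b)"
  by (simp add: is_functor_def)

lemma is_functor_Id: "is_functor C D F \<Longrightarrow> a \<in> Ob C \<Longrightarrow> far F (Id C a) = Id D (fob F a)"
  by (simp add: is_functor_def)

lemma is_functor_Comp:
  "is_functor C D F \<Longrightarrow> f \<in> mor C a b \<Longrightarrow> g \<in> mor C b c
    \<Longrightarrow> far F (g \<cdot>\<^bsub>C\<^esub> f) = far F g \<cdot>\<^bsub>D\<^esub> far F f"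
  by (simp add: is_functor_def)

lemma is_functor_iso_arrow:
  assumes "category C" and F: "is_functor C D F" and f: "f \<in> mor C a b" and "iso_arrow C f"
  shows "iso_arrow D (far F f)"
proof -
  interpret category C by fact
  obtain g where g: "g \<in> mor C b a" "g \<cdot>\<^bsub>C\<^esub> f = Id C a" "f \<cdot>\<^bsub>C\<^esub> g = Id C b"
    using assms(4) inverse_arrows_mor[OF f] by (auto simp: iso_arrow_def)
  have "far F g \<cdot>\<^bsub>D\<^esub> far F f = Id D (fob F a)" "far F f \<cdot>\<^bsub>D\<^esub> far F g = Id D (fob F b)"
    using is_functor_Comp[OF F f g(1)] is_functor_Comp[OF F g(1) f] g
      is_functor_Id[OF F] mor_Ob[OF f] by auto
  then show ?thesis
    unfolding iso_arrow_def
    using inverse_arrows_mor[OF is_functor_mor[OF F f]] is_functor_mor[OF F g(1)] by blast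
qed

text \<open>An arrow \<open>h : F a \<rightarrow> b\<close> can be recovered from its transpose
  \<open>G h \<cdot> \<eta> a\<close> by applying \<open>F\<close> and composing with
  \<open>\<epsilon> b\<close>: naturality of the counit moves \<open>h\<close> to the left of
  \<open>\<epsilon> (F a)\<close>, and the triangle identity at \<open>a\<close> removes what
  remains. So transposition has a left inverse.\<close>

lemma adjunction_transpose_inject:
  assumes "category C" and "category D" and adj: "adjunction C D F G \<eta> \<epsilon>"
    and a: "a \<in> Ob C" and f: "f \<in> mor D (fob F a) b" and g: "g \<in> mor D (fob F a) b"
    and eq: "far G f \<cdot>\<^bsub>C\<^esub> \<eta> a = far G g \<cdot>\<^bsub>C\<^esub> \<eta> a"
  shows "f = g"
proof -
  interpret C: category C by fact
  interpret D: category D by fact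
  have F: "is_functor C D F" and G: "is_functor D C G"
    and \<eta>: "\<eta> a \<in> mor C a (fob G (fob F a))"
    and \<epsilon>: "\<And>b. b \<in> Ob D \<Longrightarrow> \<epsilon> b \<in> mor D (fob F (fob G b)) b"
    and \<epsilon>_nat: "\<And>x y h. h \<in> mor D x y \<Longrightarrow> \<epsilon> y \<cdot>\<^bsub>D\<^esub> far F (far G h) = h \<cdot>\<^bsub>D\<^esub> \<epsilon> x"
    and tri: "\<epsilon> (fob F a) \<cdot>\<^bsub>D\<^esub> far F (\<eta> a) = Id D (fob F a)"
    using adj a by (auto simp: adjunction_def natural_def comp_ftor_def id_ftor_def)
  have Fa: "fob F a \<in> Ob D" and b: "b \<in> Ob D"
    using D.mor_Ob[OF f] by auto
  have "h = \<epsilon> b \<cdot>\<^bsub>D\<^esub> far F (far G h \<cdot>\<^bsub>C\<^esub> \<eta> a)" if h: "h \<in> mor D (fob F a) b" for h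
  proof -
    have Gh: "far G h \<in> mor C (fob G (fob F a)) (fob G b)" using is_functor_mor[OF G h] .
    have "h = h \<cdot>\<^bsub>D\<^esub> (\<epsilon> (fob F a) \<cdot>\<^bsub>D\<^esub> far F (\<eta> a))"
      using tri D.Comp_Id[OF h] by simp
    also have "\<dots> = (h \<cdot>\<^bsub>D\<^esub> \<epsilon> (fob F a)) \<cdot>\<^bsub>D\<^esub> far F (\<eta> a)"
      using D.Comp_assoc[OF is_functor_mor[OF F \<eta>] \<epsilon>[OF Fa] h] by simp
    also have "\<dots> = (\<epsilon> b \<cdot>\<^bsub>D\<^esub> far F (far G h)) \<cdot>\<^bsub>D\<^esub> far F (\<eta> a)"
      using \<epsilon>_nat[OF h] by simp
    also have "\<dots> = \<epsilon> b \<cdot>\<^bsub>D\<^esub> (far F (far G h) \<cdot>\<^bsub>D\<^esub> far F (\<eta> a))"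
      using D.Comp_assoc[OF is_functor_mor[OF F \<eta>] is_functor_mor[OF F Gh] \<epsilon>[OF b]] .
    also have "\<dots> = \<epsilon> b \<cdot>\<^bsub>D\<^esub> far F (far G h \<cdot>\<^bsub>C\<^esub> \<eta> a)"
      using is_functor_Comp[OF F \<eta> Gh] by simp
    finally show ?thesis .
  qed
  then show ?thesis using f g eq by metis
qed

section \<open>The comparison isomorphisms between \<open>F(a[n])\<close> and \<open>F(a)[n]\<close>
  for an exact functor\<close>

context
  fixes C :: "('o, 'm, 'z) tri_cat_scheme" and D :: "('o2, 'm2, 'y) tri_cat_scheme" and F \<xi>
  assumes C: "triangulated_category C" and D: "triangulated_category D"
    and F: "exact_functor C D F \<xi>"
begin

interpretation C: triangulated_category C by (rule C)
interpretation D: triangulated_category D by (rule D)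

text \<open>Typing and invertibility go through one induction: the step shifts the previous arrow by
  1, which preserves both, and precomposes it with the isomorphism \<open>\<xi>\<close> at
  \<open>a[n]\<close>.\<close>

lemma shift_iso_nat_iso:
  assumes a: "a \<in> Ob C"
  shows "shift_iso_nat C D F \<xi> n a \<in> mor D (fob F (sho C a (int n))) (sho D (fob F a) (int n))
    \<and> iso_arrow D (shift_iso_nat C D F \<xi> n a)"
proof (induction n)
  case 0
  have "fob F a \<in> Ob D"
    using F a by (auto simp: exact_functor_def additive_functor_def intro: is_functor_Ob)
  then show ?case
    using a by (simp add: C.Shift_0_ob D.Shift_0_ob D.Id_mor D.iso_arrow_Id)
next
  case (Suc n)
  have functor_F: "is_functor C D F" and functor_C: "is_functor C C (Shift C (int n))"
    and functor_D: "is_functor D D (Shift D 1)"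
    using F C.Shift_additive D.Shift_additive by (auto simp: exact_functor_def additive_functor_def)
  have an: "sho C a (int n) \<in> Ob C" using is_functor_Ob[OF functor_C a] .
  have Fa: "fob F a \<in> Ob D" using is_functor_Ob[OF functor_F a] .
  have \<xi>: "\<xi> (sho C a (int n)) \<in>
      mor D (fob F (sho C (sho C a (int n)) 1)) (sho D (fob F (sho C a (int n))) 1)"
    "iso_arrow D (\<xi> (sho C a (int n)))"
    using F an by (auto simp: exact_functor_def natural_def comp_ftor_def)
  have s: "sha D (shift_iso_nat C D F \<xi> n a) 1 \<in>
      mor D (sho D (fob F (sho C a (int n))) 1) (sho D (sho D (fob F a) (int n)) 1)"
    "iso_arrow D (sha D (shift_iso_nat C D F \<xi> n a) 1)"
    using Suc is_functor_mor[OF functor_D] is_functor_iso_arrow[OF D.category_axioms functor_D]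
    by blast+
  \<comment> \<open>Composition yields an arrow from \<open>F(a[n][1])\<close> to
    \<open>F(a)[n][1]\<close>. Shifts add strictly on objects, so these are the objects required for
    \<open>Suc n\<close>.\<close>
  show ?case
    using D.Comp_mor[OF \<xi>(1) s(1)] D.iso_arrow_Comp[OF \<xi>(1) s(1) \<xi>(2) s(2)]
      C.Shift_add_ob[OF a, of 1 "int n"] D.Shift_add_ob[OF Fa, of 1 "int n"]
    by simp
qed

text \<open>For negative \<open>n\<close> the iterated isomorphism is taken at \<open>a[n]\<close>
  with exponent \<open>-n\<close>. It points from \<open>F(a)\<close> to \<open>F(a[n])[-n]\<close>,
  so shifting by \<open>n\<close> and inverting gives the required direction.\<close>

lemma shift_iso_iso:
  assumes a: "a \<in> Ob C"
  shows "shift_iso C D F \<xi> n a \<in> mor D (fob F (sho C a n)) (sho D (fob F a) n)"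
    and "iso_arrow D (shift_iso C D F \<xi> n a)"
proof -
  have "shift_iso C D F \<xi> n a \<in> mor D (fob F (sho C a n)) (sho D (fob F a) n)
    \<and> iso_arrow D (shift_iso C D F \<xi> n a)"
  proof (cases "0 \<le> n")
    case True
    then show ?thesis
      using shift_iso_nat_iso[OF a, of "nat n"] by (simp add: shift_iso_def)
  next
    case False
    let ?k = "nat (- n)" and ?s = "shift_iso_nat C D F \<xi> (nat (- n)) (sho C a n)"
    have functor_F: "is_functor C D F" and functor_C: "is_functor C C (Shift C n)"
      and functor_D: "is_functor D D (Shift D n)"
      using F C.Shift_additive D.Shift_additive by (auto simp: exact_functor_def additive_functor_def)
    have an: "sho C a n \<in> Ob C" using is_functor_Ob[OF functor_C a] .
    have Fan: "fob F (sho C a n) \<in> Ob D" using is_functor_Ob[OF functor_F an] .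
    \<comment> \<open>As \<open>int ?k\<close> is \<open>- n\<close>, the two shifts cancel on the
      nose, which identifies the source of \<open>?s\<close> with \<open>F(a)\<close>.\<close>
    have "sho C (sho C a n) (int ?k) = a"
      using C.Shift_add_ob[OF a, of "- n" n] C.Shift_0_ob[OF a] False by simp
    then have s: "?s \<in> mor D (fob F a) (sho D (fob F (sho C a n)) (int ?k))" "iso_arrow D ?s"
      using shift_iso_nat_iso[OF an, of ?k] by auto
    \<comment> \<open>The same cancellation, now in \<open>D\<close>, for the target of
      \<open>?s\<close> after its shift by \<open>n\<close>.\<close>
    have "sho D (sho D (fob F (sho C a n)) (int ?k)) n = fob F (sho C a n)"
      using D.Shift_add_ob[OF Fan, of n "- n"] D.Shift_0_ob[OF Fan] False by simp
    then have "sha D ?s n \<in> mor D (sho D (fob F a) n) (fob F (sho C a n))"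
      "iso_arrow D (sha D ?s n)"
      using is_functor_mor[OF functor_D s(1)]
        is_functor_iso_arrow[OF D.category_axioms functor_D s] by auto
    then show ?thesis
      using D.inv_arrow False by (simp add: shift_iso_def)
  qed
  then show "shift_iso C D F \<xi> n a \<in> mor D (fob F (sho C a n)) (sho D (fob F a) n)"
    "iso_arrow D (shift_iso C D F \<xi> n a)" by auto
qed

end

section \<open>The adjunction isomorphism on graded classes, for a fixed
  \<open>i : Z \<rightarrow> X\<close>\<close>

context
  fixes S :: "('s, 'f, 'p) geometry" and K :: "('s, 'f, 'o, 'm) coefficients"
    and X Z :: 's and i :: 'f and R :: "('o, 'm) recollement_data" and A :: 'o
  assumes coeff: "coefficient_system S K" and i: "i \<in> mor S Z X"
    and shriek: "fob (ishriek R) A \<in> Ob (CC K Z)"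
begin

interpretation coefficient_system S K by (rule coeff)

interpretation X: triangulated_category "CC K X"
  using CC_triangulated mor_Ob(2)[OF i] .

interpretation Z: triangulated_category "CC K Z"
  using CC_triangulated mor_Ob(1)[OF i] .

interpretation pull: sym_monoidal_functor "CC K X" "CC K Z" "pull K i" "pull_mu K i" "pull_iota K i"
  using pull_sym_monoidal[OF i] .

lemma push_functor: "is_functor (CC K Z) (CC K X) (push K i)"
  using pull_push[OF i] by (simp add: adjunction_def)

lemma ps_unit_mor:
  "ps_unit K i (Unit (CC K X)) \<in>
    mor (CC K X) (Unit (CC K X)) (fob (push K i) (fob (pull K i) (Unit (CC K X))))"
  using pull_push[OF i] pull.C.Unit_Ob
  by (simp add: adjunction_def natural_def comp_ftor_def id_ftor_def)

text \<open>The last arrow of the adjoint class: the comparison for \<open>i\<^sub>*\<close> at the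
  object \<open>i\<^sup>!A\<close>.\<close>

lemmas push_shift_iso = shift_iso_iso[OF Z.triangulated_category_axioms
  X.triangulated_category_axioms push_exact[OF i] shriek]

text \<open>The arrow from \<open>i\<^sup>*1\<^sub>X\<close> to \<open>1\<^sub>Z\<close>, the
  direction in which \<open>adjoint_class\<close> uses the unit isomorphism.\<close>

lemmas inv_iota = Z.inv_arrow[OF pull.iota_mor pull.iota_iso]

text \<open>In each degree \<open>d\<close> the arrows compose through
  \<open>i\<^sub>*i\<^sup>*1\<^sub>X\<close> and \<open>i\<^sub>*((i\<^sup>!A)[d])\<close> and end
  in \<open>(i\<^sub>*i\<^sup>!A)[d]\<close>. This is the support half of membership in the
  torsor.\<close>

lemma adjoint_class_in_H_supp:
  assumes m: "m \<in> graded_hom (CC K Z) D (Unit (CC K Z)) (fob (ishriek R) A)"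
  shows "adjoint_class K R D i Z X A m \<in> H_supp K R D i X A"
  unfolding H_supp_def graded_hom_def adjoint_class_def
proof (rule restrict_PiE_iff[THEN iffD2], rule ballI)
  fix d assume "d \<in> D"
  then have "m d \<in> mor (CC K Z) (Unit (CC K Z)) (sho (CC K Z) (fob (ishriek R) A) d)"
    using m by (auto simp: graded_hom_def)
  from is_functor_mor[OF push_functor Z.Comp_mor[OF inv_iota(1) this]]
  show "shift_iso (CC K Z) (CC K X) (push K i) (push_xi K i) d (fob (ishriek R) A)
      \<cdot>\<^bsub>CC K X\<^esub> far (push K i) (m d \<cdot>\<^bsub>CC K Z\<^esub> inv_arrow (CC K Z) (pull_iota K i))
      \<cdot>\<^bsub>CC K X\<^esub> ps_unit K i (Unit (CC K X))
    \<in> mor (CC K X) (Unit (CC K X)) (sho (CC K X) (fob (push K i) (fob (ishriek R) A)) d)"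
    using X.Comp_mor ps_unit_mor push_shift_iso(1) by blast
qed

text \<open>In each degree the layers of the adjoint are stripped from the outside inwards: first
  the shift comparison, then the transposition, finally the unit isomorphism.\<close>

lemma inj_on_adjoint_class:
  "inj_on (adjoint_class K R D i Z X A)
    (graded_hom (CC K Z) D (Unit (CC K Z)) (fob (ishriek R) A))"
proof (rule inj_onI)
  fix m m'
  assume m: "m \<in> graded_hom (CC K Z) D (Unit (CC K Z)) (fob (ishriek R) A)"
    and m': "m' \<in> graded_hom (CC K Z) D (Unit (CC K Z)) (fob (ishriek R) A)"
    and eq: "adjoint_class K R D i Z X A m = adjoint_class K R D i Z X A m'"
  have "m d = m' d" if d: "d \<in> D" for d
  proof -
    let ?\<sigma> = "shift_iso (CC K Z) (CC K X) (push K i) (push_xi K i) d (fob (ishriek R) A)"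
    let ?t = "\<lambda>n. n d \<cdot>\<^bsub>CC K Z\<^esub> inv_arrow (CC K Z) (pull_iota K i)"
    let ?u = "ps_unit K i (Unit (CC K X))"
    have md: "m d \<in> mor (CC K Z) (Unit (CC K Z)) (sho (CC K Z) (fob (ishriek R) A) d)"
      "m' d \<in> mor (CC K Z) (Unit (CC K Z)) (sho (CC K Z) (fob (ishriek R) A) d)"
      using m m' d by (auto simp: graded_hom_def)
    note t = Z.Comp_mor[OF inv_iota(1) md(1)] Z.Comp_mor[OF inv_iota(1) md(2)]
    have "?\<sigma> \<cdot>\<^bsub>CC K X\<^esub> far (push K i) (?t m) \<cdot>\<^bsub>CC K X\<^esub> ?u
        = ?\<sigma> \<cdot>\<^bsub>CC K X\<^esub> far (push K i) (?t m') \<cdot>\<^bsub>CC K X\<^esub> ?u"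
      using fun_cong[OF eq, of d] d by (simp add: adjoint_class_def)
    then have "far (push K i) (?t m) \<cdot>\<^bsub>CC K X\<^esub> ?u = far (push K i) (?t m') \<cdot>\<^bsub>CC K X\<^esub> ?u"
      by (rule X.iso_arrow_left_cancel[OF push_shift_iso
            X.Comp_mor[OF ps_unit_mor is_functor_mor[OF push_functor t(1)]]
            X.Comp_mor[OF ps_unit_mor is_functor_mor[OF push_functor t(2)]]])
    \<comment> \<open>The adjunction here is \<open>i\<^sup>* \<stileturn> i\<^sub>*\<close> at the
      object \<open>1\<^sub>X\<close>: both sides are transposes of arrows out of
      \<open>i\<^sup>*1\<^sub>X\<close>.\<close>
    then have "?t m = ?t m'"
      by (rule adjunction_transpose_inject[OF X.category_axioms Z.category_axioms
            pull_push[OF i] pull.C.Unit_Ob t])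
    then show ?thesis
      by (rule Z.iso_arrow_right_cancel[OF inv_iota(1,4) md])
  qed
  \<comment> \<open>Graded classes are extensional families, so agreement on the degrees in
    \<open>D\<close> is equality.\<close>
  then show "m = m'"
    using m m' unfolding graded_hom_def by (rule PiE_ext[rotated 2])
qed

end

section \<open>Compatible assignments as points of the Milnor localisation torsor\<close>

theorem theorem10p11:
  fixes S :: "('s, 'f, 'p) geometry"
    and K :: "('s, 'f, 'o, 'm) coefficients"
    and X Z U :: 's and i j :: 'f
    and R :: "('o, 'm) recollement_data"
    and D :: "int set" and A :: 'o and T :: "'m characteristic_theory"
  assumes "coefficient_system S K"
    and "singular S X"
    and "singular_locus S i Z X" and "regular_locus S j U X"
    and "recollement K X Z U i j R"
    and "characteristic_theory K D X U j A T"
  shows "(\<forall>\<M>. compatible_assignment K R D i Z X A T \<M> \<longrightarrow>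
            adjoint_class K R D i Z X A (\<M> (defect K D X T)) \<in> milnor_torsor K R D i X A T) \<and>
         (is_singleton (milnor_torsor K R D i X A T) \<longrightarrow>
            (\<forall>\<M> \<M>'. compatible_assignment K R D i Z X A T \<M> \<and>
                    compatible_assignment K R D i Z X A T \<M>' \<longrightarrow>
              \<M> (defect K D X T) = \<M>' (defect K D X T)))"
proof -
  from assms(3) have i: "i \<in> mor S Z X" by (simp add: singular_locus_def)
  \<comment> \<open>The adjunction \<open>i\<^sub>* \<stileturn> i\<^sup>!\<close> includes that
    \<open>i\<^sup>!\<close> is a functor from \<open>C(X)\<close> to \<open>C(Z)\<close>.\<close>
  have "fob (ishriek R) A \<in> Ob (CC K Z)"
    using recollement.istar_ishriek[OF assms(5)] characteristic_theory.A_Ob[OF assms(6)]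
    by (auto simp: adjunction_def intro: is_functor_Ob)
  note H_supp = adjoint_class_in_H_supp[OF assms(1) i this]
    and inj = inj_on_adjoint_class[OF assms(1) i this]
  \<comment> \<open>The condition on \<open>forg\<close> is part of compatibility, so what remains
    is that the adjoint is a class with supports in \<open>Z\<close>.\<close>
  have torsor: "adjoint_class K R D i Z X A (\<M> (defect K D X T)) \<in> milnor_torsor K R D i X A T"
    if "compatible_assignment K R D i Z X A T \<M>" for \<M>
    using that H_supp by (simp add: compatible_assignment_def milnor_torsor_def)
  moreover have "\<M> (defect K D X T) = \<M>' (defect K D X T)"
    if "is_singleton (milnor_torsor K R D i X A T)"
      and c: "compatible_assignment K R D i Z X A T \<M>" "compatible_assignment K R D i Z X A T \<M>'"
    for \<M> \<M>'
  proof (rule inj_onD[OF inj])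
    \<comment> \<open>Both adjoints are the unique point of the torsor; injectivity then carries
      their equality back to the classes on \<open>Z\<close>.\<close>
    show "adjoint_class K R D i Z X A (\<M> (defect K D X T)) =
        adjoint_class K R D i Z X A (\<M>' (defect K D X T))"
      using that(1) torsor[OF c(1)] torsor[OF c(2)] by (auto simp: is_singleton_def)
  qed (use c in \<open>simp_all add: compatible_assignment_def\<close>)
  ultimately show ?thesis by blast
qed

end
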